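(* For every positive integer $n$ and every real $x>0$, $$ h(n) = \log x - \frac{\Gamma(1+n)}{x^n} \int_0^x \log\hat{x}\,(d\hat{x})^n , $$ where $h(n)=\sum_{k=1}^{n}\frac1k$ and $\int_0^x \log\hat{x}\,(d\hat{x})^n$ denotes the $n$-fold iterated integral of $\log$ with all lower limits equal to $0$.
   Context: The finite harmonic series is $h(n)=\sum_{k=1}^n \frac{1}{k}$. For a function $f$ and a positive integer $n$, the $n$-fold iterated integral with base point $a$ is $$\int_a^x f(\hat{x})\,(d\hat{x})^n = \int_a^{x}\int_a^{x_n}\int_a^{x_{n-1}}\cdots\int_a^{x_3}\int_a^{x_2} f(x_1)\,dx_1\,dx_2\cdots dx_{n-1}\,dx_n ,$$ that is, $\int_a^x f(\hat x)(d\hat x)^1=\int_a^x f(t)\,dt$ and $\int_a^x f(\hat x)(d\hat x)^{n+1}=\int_a^x\left(\int_a^{\hat x} f(\tilde x)(d\tilde x)^n\right)d\hat x$. Here $\log$ is the real natural logarithm, which is integrable near $0$. *)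

theory Defs
  imports "HOL-Analysis.Analysis"
begin

(* The n-fold iterated integral of f with all lower limits equal to a, meant for n >= 1; index 0
   is the function itself by convention, so that index 1 is the oriented integral from a to x. *)
primrec iterated_integral :: "(real \<Rightarrow> real) \<Rightarrow> real \<Rightarrow> nat \<Rightarrow> real \<Rightarrow> real" where
  "iterated_integral f a 0 x = f x"
| "iterated_integral f a (Suc n) x = (LBINT t=ereal a..ereal x. iterated_integral f a n t)"

end

theory Submission
  imports Defs "HOL-Real_Asymp.Real_Asymp"
begin

text \<open>
  The identity is a rearrangement of a closed form for the iterated integral: for \<open>x > 0\<close> the
  \<open>n\<close>-fold integral of \<open>ln\<close> from \<open>0\<close> to \<open>x\<close> equals \<open>x ^ n / n! * (ln x - harm n)\<close>. The closed form
  holds by induction on \<open>n\<close>, because differentiating the expression for \<open>n + 1\<close> gives that for \<open>n\<close>: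
  the product rule adds \<open>x ^ n / (n + 1)! = x ^ n / n! * (1 / (n + 1))\<close>, which turns \<open>harm (n + 1)\<close>
  into \<open>harm n\<close>. These antiderivatives tend to \<open>0\<close> at \<open>0\<close>, since a positive power of \<open>x\<close> beats \<open>ln x\<close>.

  The analytic obstacle is the lower limit \<open>0\<close>, where \<open>ln\<close> is unbounded, so that the limits of an
  antiderivative give the Lebesgue integral only if the integrand is known to be integrable.
  Lemma \<open>set_integrable_power_mult_ln\<close> supplies this.
\<close>

text \<open>
  The function \<open>t ^ n * ln t\<close> changes sign at \<open>1\<close> if \<open>x > 1\<close>, but \<open>t ^ n * (ln x - ln t)\<close> is nonnegative on the
  interval from \<open>0\<close> to \<open>x\<close>. For a nonnegative derivative, the existence of the limits of the
  antiderivative at both ends is enough for integrability; subtracting the result from the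
  continuous function \<open>t ^ n * ln x\<close> gives back \<open>t ^ n * ln t\<close>.
\<close>

lemma set_integrable_power_mult_ln:
  fixes x :: real
  assumes "x > 0"
  shows "set_integrable lborel (einterval (ereal 0) (ereal x)) (\<lambda>t. t ^ n * ln t)"
proof -
  \<comment> \<open>integration by parts of \<open>t ^ n * (ln x - ln t)\<close>\<close>
  define F where
    "F = (\<lambda>t::real. t ^ Suc n / real (Suc n) * (ln x - ln t) + t ^ Suc n / real (Suc n) ^ 2)"
  have *: "set_integrable lborel (einterval (ereal 0) (ereal x)) (\<lambda>t. t ^ n * (ln x - ln t))"
  proof (rule interval_integral_FTC_nonneg(1)
      [where F = F and A = 0 and B = "x ^ Suc n / real (Suc n) ^ 2"])
    show "ereal 0 < ereal x" using assms by simp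
    show "DERIV F t :> t ^ n * (ln x - ln t)" if "ereal 0 < ereal t" "ereal t < ereal x" for t
    proof -
      have "t > 0" using that by simp
      then show ?thesis
        unfolding F_def
        by (auto intro!: derivative_eq_intros simp del: of_nat_Suc power_Suc)
           (simp add: field_simps power2_eq_square power4_eq_xxxx del: of_nat_Suc)
    qed
    show "isCont (\<lambda>t. t ^ n * (ln x - ln t)) t" if "ereal 0 < ereal t" "ereal t < ereal x" for t
      using that by (auto intro!: continuous_intros)
    show "AE t in lborel. ereal 0 < ereal t \<longrightarrow> ereal t < ereal x \<longrightarrow> 0 \<le> t ^ n * (ln x - ln t)"
      by (rule AE_I2) (auto intro!: mult_nonneg_nonneg)
    have "(F \<longlongrightarrow> 0) (at_right 0)"
      unfolding F_def by real_asymp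
    then show "((F \<circ> real_of_ereal) \<longlongrightarrow> 0) (at_right (ereal 0))"
      by (simp add: ereal_tendsto_simps)
    have "isCont F x"
      unfolding F_def using assms by (auto intro!: continuous_intros)
    then have "(F \<longlongrightarrow> F x) (at_left x)"
      using isContD filterlim_at_split by blast
    then show "((F \<circ> real_of_ereal) \<longlongrightarrow> x ^ Suc n / real (Suc n) ^ 2) (at_left (ereal x))"
      by (simp add: ereal_tendsto_simps F_def)
  qed
  have "set_integrable lborel {0..x} (\<lambda>t. t ^ n * ln x)"
    by (rule borel_integrable_atLeastAtMost') (auto intro!: continuous_intros)
  then have "set_integrable lborel (einterval (ereal 0) (ereal x)) (\<lambda>t. t ^ n * ln x)"
    by (rule set_integrable_subset) auto
  from set_integral_diff(1)[OF this *] show ?thesis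
    by (simp add: algebra_simps)
qed

lemma iterated_integral_ln:
  fixes x :: real
  assumes "x > 0"
  shows "iterated_integral ln 0 n x = x ^ n / fact n * (ln x - harm n)"
  using assms
proof (induction n arbitrary: x)
  case 0
  then show ?case by (simp add: harm_def)
next
  case (Suc n)
  define f where "f = (\<lambda>t::real. t ^ n / fact n * (ln t - harm n))"
  define F where "F = (\<lambda>t::real. t ^ Suc n / fact (Suc n) * (ln t - harm (Suc n)))"
  have "iterated_integral ln 0 (Suc n) x = (LBINT t=ereal 0..ereal x. f t)"
    unfolding iterated_integral.simps f_def
    by (rule interval_integral_cong) (use Suc in \<open>simp add: einterval_def\<close>)
  also have "\<dots> = F x - 0"
  proof (rule interval_integral_FTC_integrable)
    show "ereal 0 < ereal x" using Suc by simp
    show "(F has_vector_derivative f t) (at t)" if "ereal 0 < ereal t" "ereal t < ereal x" for t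
    proof -
      have "t > 0" using that by simp
      then have "DERIV F t :> f t"
        unfolding F_def f_def
        by (auto intro!: derivative_eq_intros simp del: of_nat_Suc power_Suc fact_Suc)
           (simp add: harm_Suc field_simps del: of_nat_Suc)
      then show ?thesis by (simp add: has_real_derivative_iff_has_vector_derivative)
    qed
    show "isCont f t" if "ereal 0 < ereal t" "ereal t < ereal x" for t
      using that unfolding f_def by (auto intro!: continuous_intros)
    have "set_integrable lborel {0..x} (\<lambda>t. t ^ n * harm n)"
      by (rule borel_integrable_atLeastAtMost') (auto intro!: continuous_intros)
    then have "set_integrable lborel (einterval (ereal 0) (ereal x)) (\<lambda>t. t ^ n * harm n)"
      by (rule set_integrable_subset) auto
    from set_integral_diff(1)[OF set_integrable_power_mult_ln[OF Suc.prems] this]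
    have "set_integrable lborel (einterval (ereal 0) (ereal x))
            (\<lambda>t. (t ^ n * ln t - t ^ n * harm n) / fact n)"
      by (intro set_integrable_divide)
    then show "set_integrable lborel (einterval (ereal 0) (ereal x)) f"
      by (simp add: f_def algebra_simps)
    have "(F \<longlongrightarrow> 0) (at_right 0)"
      unfolding F_def by real_asymp
    then show "((F \<circ> real_of_ereal) \<longlongrightarrow> 0) (at_right (ereal 0))"
      by (simp add: ereal_tendsto_simps)
    have "isCont F x"
      unfolding F_def using Suc by (auto intro!: continuous_intros)
    then have "(F \<longlongrightarrow> F x) (at_left x)"
      using isContD filterlim_at_split by blast
    then show "((F \<circ> real_of_ereal) \<longlongrightarrow> F x) (at_left (ereal x))"
      by (simp add: ereal_tendsto_simps)
  qed
  finally show ?case by (simp add: F_def)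
qed

theorem theorem2:
  fixes n :: nat and x :: real
  assumes "n \<ge> 1" and "x > 0"
  shows "harm n = ln x - Gamma (1 + real n) / x ^ n * iterated_integral ln 0 n x"
  using assms by (simp add: iterated_integral_ln Gamma_fact)

end
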